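(* Consider the constraints, for all $k$ and all $j$, $$\text{(C1)}\quad d^k_j\ \ge\ d^{k-b_j}_{j-1}+r^k_j(h^k_j,x_j)+w^k_j(h^k_j,x_j),\qquad \text{(C2)}\quad d^k_j\ \ge\ d^{k-\bar b_{j+1}}_{j+1}+\underline s_{j+1},$$ with the dwell time law $w^k_j(h^k_j,x_j)=\min(x_jh^k_j,\bar w_j)$ and the run time law $r^k_j(h^k_j,x_j)=\max\{\underline r_j,\ \underline r_j+\Delta r_j-x_j(h^k_j-\underline h_j)\}$. If $h^1_j\le\bar h_j=\frac{1}{1-x_j}\bar g_j$ for all $j$ and $\Delta r_j\ge\Delta w_j=X_j\Delta g_j$ for all $j$, then the constraints (C1)–(C2) form a max-plus linear system, and are equivalent to $$d^k_j\ge d^{k-b_j}_{j-1}+\tilde r_j+X_j\underline g_j,\qquad d^k_j\ge d^{k-\bar b_{j+1}}_{j+1}+\underline s_{j+1}.$$ The dynamics is then written $$d^k_j=\max\left\{d^{k-b_j}_{j-1}+\tilde r_j+X_j\underline g_j,\ \ d^{k-\bar b_{j+1}}_{j+1}+\underline s_{j+1}\right\}.$$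
   Context: A linear metro line (no junction) is discretized as a closed loop of $n$ segments; segment $j$ connects nodes $j-1$ and $j$ (indices taken cyclically modulo $n$), and holds at most one train. $b_j\in\{0,1\}$ is the number of trains on segment $j$ at time zero, $\bar b_j=1-b_j$. $d^k_j$ and $a^k_j$ are the $k$-th departure time from and arrival time to node $j$; $h^k_j=d^k_j-d^{k-1}_j$ is the train time-headway; $g^k_j=a^k_j-d^{k-1}_j$ is the dynamic interval, $h=g+w$. A train departs from a node as soon as its two constraints (travel time and safe separation) are satisfied; $\underline s_j$ is the minimum safe separation time. Passenger demand parameter: at a platform $j$, $x_j=\lambda^{\rm out}_j/\alpha^{\rm out}_j+\lambda^{\rm in}_j/\alpha^{\rm in}_j$ (average passenger departure/arrival rates divided by average alighting/boarding capacities), with $0\le x_j<1$ ($x_j=0$ if there is no platform at node $j$); $X_j:=x_j/(1-x_j)$. $\underline g_j\le\bar g_j$ are given minimum and maximum dynamic intervals. Set $\underline h_j=\underline g_j/(1-x_j)$, $\bar h_j=\bar g_j/(1-x_j)$, $\underline w_j=x_j\underline h_j=X_j\underline g_j$, $\bar w_j=x_j\bar h_j=X_j\bar g_j$, $\Delta g_j=\bar g_j-\underline g_j$, $\Delta w_j=\bar w_j-\underline w_j$ (so $\Delta w_j=X_j\Delta g_j$). $\underline r_j$ is the minimum run time on segment $j$, $\tilde r_j$ the nominal run time and $\Delta r_j=\tilde r_j-\underline r_j\geq 0$ the run time margin. Max-plus linear: each $d^k_j$ is a maximum of variables plus constants.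
   Formalization: Added hypothesis, as the claim fails when the bounds h̄_j differ between nodes: at every j with x_j>0 and Δr_j>Δw_j, all initial headways h^1_i (not only h^1_j) are at most h̄_j. Minimum run and separation times are taken positive, and minimum dynamic intervals nonnegative. *)

theory Defs
  imports "HOL-Analysis.Analysis"
begin

text \<open>
  Nodes and segments of the closed loop are numbered by \<open>{..<segs L}\<close>, cyclically: segment \<open>j\<close>
  leads from node \<open>prv L j\<close> to node \<open>j\<close>.  All fields are only relevant at indices below \<open>segs L\<close>.
\<close>

record metro =
  segs :: nat
  trains :: "nat \<Rightarrow> nat"            \<comment> \<open>number of trains on a segment at time zero\<close>
  platform :: "nat \<Rightarrow> bool"
  lam_out :: "nat \<Rightarrow> real"          \<comment> \<open>average passenger departure rate\<close>
  alpha_out :: "nat \<Rightarrow> real"        \<comment> \<open>average alighting capacity\<close>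
  lam_in :: "nat \<Rightarrow> real"           \<comment> \<open>average passenger arrival rate\<close>
  alpha_in :: "nat \<Rightarrow> real"         \<comment> \<open>average boarding capacity\<close>
  g_min :: "nat \<Rightarrow> real"            \<comment> \<open>dynamic intervals\<close>
  g_max :: "nat \<Rightarrow> real"
  r_min :: "nat \<Rightarrow> real"            \<comment> \<open>run times\<close>
  r_nom :: "nat \<Rightarrow> real"
  s_min :: "nat \<Rightarrow> real"            \<comment> \<open>safe separation time\<close>

definition nxt :: "metro \<Rightarrow> nat \<Rightarrow> nat" where
  "nxt L j = (j + 1) mod segs L"

definition prv :: "metro \<Rightarrow> nat \<Rightarrow> nat" where
  "prv L j = (j + segs L - 1) mod segs L"

definition trains_bar :: "metro \<Rightarrow> nat \<Rightarrow> nat" where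
  "trains_bar L j = 1 - trains L j"

definition demand :: "metro \<Rightarrow> nat \<Rightarrow> real" where
  "demand L j =
    (if platform L j then lam_out L j / alpha_out L j + lam_in L j / alpha_in L j else 0)"

definition demand_ratio :: "metro \<Rightarrow> nat \<Rightarrow> real" where
  "demand_ratio L j = demand L j / (1 - demand L j)"

definition h_min :: "metro \<Rightarrow> nat \<Rightarrow> real" where
  "h_min L j = g_min L j / (1 - demand L j)"

definition h_max :: "metro \<Rightarrow> nat \<Rightarrow> real" where
  "h_max L j = g_max L j / (1 - demand L j)"

definition w_min :: "metro \<Rightarrow> nat \<Rightarrow> real" where
  "w_min L j = demand L j * h_min L j"

definition w_max :: "metro \<Rightarrow> nat \<Rightarrow> real" where
  "w_max L j = demand L j * h_max L j"

definition delta_g :: "metro \<Rightarrow> nat \<Rightarrow> real" where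
  "delta_g L j = g_max L j - g_min L j"

definition delta_w :: "metro \<Rightarrow> nat \<Rightarrow> real" where
  "delta_w L j = w_max L j - w_min L j"

definition delta_r :: "metro \<Rightarrow> nat \<Rightarrow> real" where
  "delta_r L j = r_nom L j - r_min L j"

lemma w_min_eq: "w_min L j = demand_ratio L j * g_min L j"
  by (simp add: w_min_def h_min_def demand_ratio_def)

lemma w_max_eq: "w_max L j = demand_ratio L j * g_max L j"
  by (simp add: w_max_def h_max_def demand_ratio_def)

lemma delta_w_eq: "delta_w L j = demand_ratio L j * delta_g L j"
  by (simp add: delta_w_def w_min_eq w_max_eq delta_g_def right_diff_distrib)

definition metro_line :: "metro \<Rightarrow> bool" where
  "metro_line L \<longleftrightarrow> 0 < segs L \<and>
    (\<forall>j < segs L.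
      trains L j \<in> {0, 1} \<and>
      0 \<le> demand L j \<and> demand L j < 1 \<and>
      0 \<le> g_min L j \<and> g_min L j \<le> g_max L j \<and>
      0 < r_min L j \<and> r_min L j \<le> r_nom L j \<and>
      0 < s_min L j)"

text \<open>
  \<open>d k j\<close> is the \<open>k\<close>-th departure time from node \<open>j\<close>.  The row \<open>d 0\<close> is the initial condition;
  constraints and headways refer to \<open>k \<ge> 1\<close>.
\<close>

type_synonym departures = "nat \<Rightarrow> nat \<Rightarrow> real"

definition headway :: "departures \<Rightarrow> nat \<Rightarrow> nat \<Rightarrow> real" where
  "headway d k j = d k j - d (k - 1) j"

definition dwell_time :: "metro \<Rightarrow> nat \<Rightarrow> real \<Rightarrow> real" where
  "dwell_time L j h = min (demand L j * h) (w_max L j)"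

definition run_time :: "metro \<Rightarrow> nat \<Rightarrow> real \<Rightarrow> real" where
  "run_time L j h = max (r_min L j) (r_min L j + delta_r L j - demand L j * (h - h_min L j))"

definition travel_constraint :: "metro \<Rightarrow> departures \<Rightarrow> nat \<Rightarrow> nat \<Rightarrow> bool" where
  "travel_constraint L d k j \<longleftrightarrow>
    d k j \<ge> d (k - trains L j) (prv L j)
      + run_time L j (headway d k j) + dwell_time L j (headway d k j)"

definition separation_constraint :: "metro \<Rightarrow> departures \<Rightarrow> nat \<Rightarrow> nat \<Rightarrow> bool" where
  "separation_constraint L d k j \<longleftrightarrow>
    d k j \<ge> d (k - trains_bar L (nxt L j)) (nxt L j) + s_min L (nxt L j)"

definition linear_travel_constraint :: "metro \<Rightarrow> departures \<Rightarrow> nat \<Rightarrow> nat \<Rightarrow> bool" where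
  "linear_travel_constraint L d k j \<longleftrightarrow>
    d k j \<ge> d (k - trains L j) (prv L j) + r_nom L j + demand_ratio L j * g_min L j"

text \<open>
  \<open>retime d k j t\<close> moves the \<open>k\<close>-th departure from node \<open>j\<close> to time \<open>t\<close>.  A family \<open>P\<close> of
  constraints is obeyed as soon as possible if every departure takes place at the least time
  at which its own constraints hold, all other departures being kept.  The constraint on \<open>d k j\<close>
  is implicit, since the headway \<open>headway d k j\<close> moves along with \<open>t\<close>.
\<close>

definition retime :: "departures \<Rightarrow> nat \<Rightarrow> nat \<Rightarrow> real \<Rightarrow> departures" where
  "retime d k j t = d(k := (d k)(j := t))"

definition asap ::
    "metro \<Rightarrow> (departures \<Rightarrow> nat \<Rightarrow> nat \<Rightarrow> bool) \<Rightarrow> departures \<Rightarrow> bool" where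
  "asap L P d \<longleftrightarrow>
    (\<forall>k\<ge>1. \<forall>j<segs L. P d k j \<and> (\<forall>t. P (retime d k j t) k j \<longrightarrow> d k j \<le> t))"

definition metro_dynamics :: "metro \<Rightarrow> departures \<Rightarrow> bool" where
  "metro_dynamics L =
    asap L (\<lambda>d k j. travel_constraint L d k j \<and> separation_constraint L d k j)"

definition linear_metro_dynamics :: "metro \<Rightarrow> departures \<Rightarrow> bool" where
  "linear_metro_dynamics L =
    asap L (\<lambda>d k j. linear_travel_constraint L d k j \<and> separation_constraint L d k j)"

text \<open>
  A dynamics \<open>S\<close> on \<open>n\<close> nodes is max-plus linear on the trajectories satisfying \<open>I\<close> if there it is
  given by equations expressing each \<open>d k j\<close> as a maximum of variables plus constants.  The
  finite, nonempty set \<open>E j\<close> of triples (node, delay, constant) depends neither on \<open>k\<close> nor on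
  the trajectory.
\<close>

definition max_plus_linear_on ::
    "nat \<Rightarrow> (departures \<Rightarrow> bool) \<Rightarrow> (departures \<Rightarrow> bool) \<Rightarrow> bool" where
  "max_plus_linear_on n I S \<longleftrightarrow>
    (\<exists>E :: nat \<Rightarrow> (nat \<times> nat \<times> real) set.
      (\<forall>j<n. finite (E j) \<and> E j \<noteq> {} \<and> (\<forall>(i, l, c) \<in> E j. i < n \<and> l \<le> 1)) \<and>
      (\<forall>d. I d \<longrightarrow>
        (S d \<longleftrightarrow> (\<forall>k\<ge>1. \<forall>j<n. d k j = Max {d (k - l) i + c | i l c. (i, l, c) \<in> E j}))))"

definition initial_headways_bounded :: "metro \<Rightarrow> departures \<Rightarrow> bool" where
  "initial_headways_bounded L d \<longleftrightarrow> (\<forall>j<segs L. headway d 1 j \<le> h_max L j)"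

text \<open>
  When the bounds \<open>h_max L j\<close> differ from node to node, bounding each initial headway by the bound
  of its own node is not enough: the dynamics only keeps all later headways below the largest
  initial headway of the whole line.  At a node with demand whose run time margin strictly exceeds
  its dwell time margin, the travel constraint is strictly weaker than the linear one as soon as
  the headway exceeds \<open>h_max L j\<close>; the following condition therefore bounds all the initial headways
  by \<open>h_max L j\<close> for these \<open>j\<close>.  It holds trivially if \<open>delta_r L j = delta_w L j\<close> for all \<open>j\<close>, and
  it follows from \<open>initial_headways_bounded\<close> if \<open>h_max L\<close> is the same at all nodes.
\<close>

definition surplus_margin_bound :: "metro \<Rightarrow> departures \<Rightarrow> bool" where
  "surplus_margin_bound L d \<longleftrightarrow>
    (\<forall>j<segs L. 0 < demand L j \<and> delta_w L j < delta_r L j \<longrightarrow>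
      (\<forall>i<segs L. headway d 1 i \<le> h_max L j))"

end

theory Submission
  imports Defs
begin

text \<open>
  Fix a node and write \<open>C\<close> for the constant of the linear travel constraint.
  Up to the headway \<open>h_max\<close>, the run time loses exactly what the dwell time gains, and the total
  travel time is \<open>C\<close>; the margin hypothesis says that the run time does not reach its minimum
  before that.  Beyond \<open>h_max\<close> the dwell time is saturated while the run time may decrease further.
  So the total travel time is a positive \<^emph>\<open>nonincreasing\<close> function of the headway
  (\<open>travel_time_closed_form\<close>), and it differs from \<open>C\<close> only beyond \<open>h_max\<close> at a node with
  demand and a surplus of run time margin.

  It remains to exclude such headways.  For any travel time law that is positive and nonincreasing,
  an upper bound \<open>H\<close> on all initial headways propagates to all later ones
  (\<open>headway_le_initial_bound\<close>): shifting by \<open>H\<close> the time at which a train was allowed to leave gives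
  a time at which the next train is allowed to leave.  The law may be constant, so
  this covers the nonlinear and the linear dynamics alike.  Once the headway \<open>d k j - d (k - 1) j\<close> is
  at most \<open>h_max\<close>, the nonlinear and the linear travel constraint on \<open>d k j\<close> are satisfied by the same
  departure times, hence have the same least solution, and the two dynamics agree.  The least
  solution of the linear constraints is the maximum of their right-hand sides.

  Departure times in the same row \<open>k\<close> may refer to each other around the loop.
  But travel and separation times are positive, so each departure is strictly later than the ones
  it waits for.  Hence a row can be treated in the order of its departure times, and no departure
  waits for itself, even on a loop with one segment.
\<close>

section \<open>Travel times as a function of the headway\<close>

definition travel_time :: "metro \<Rightarrow> nat \<Rightarrow> real \<Rightarrow> real" where
  "travel_time L j h = run_time L j h + dwell_time L j h"

definition linear_travel_time :: "metro \<Rightarrow> nat \<Rightarrow> real" where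
  "linear_travel_time L j = r_nom L j + demand_ratio L j * g_min L j"

text \<open>
  The summand \<open>demand L j * h\<close> of the dwell time cancels against the one of the run time until the
  dwell time saturates.  Without the margin hypothesis the run time could reach its minimum first,
  and the travel time would then grow with the headway.
\<close>

lemma travel_time_closed_form:
  assumes "delta_w L j \<le> delta_r L j"
  shows "travel_time L j h =
    max (r_min L j + w_max L j) (linear_travel_time L j - max 0 (demand L j * h - w_max L j))"
proof -
  have "demand L j * (h - h_min L j) = demand L j * h - w_min L j"
    by (simp add: w_min_def right_diff_distrib)
  moreover have "linear_travel_time L j = r_nom L j + w_min L j"
    by (simp add: linear_travel_time_def w_min_eq)
  ultimately show ?thesis
    using assms
    by (auto simp: travel_time_def run_time_def dwell_time_def delta_w_def delta_r_def
        max_def min_def)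
qed

lemma travel_time_antimono:
  assumes "metro_line L" "j < segs L" "delta_w L j \<le> delta_r L j" "h \<le> h'"
  shows "travel_time L j h' \<le> travel_time L j h"
proof -
  have "demand L j * h \<le> demand L j * h'"
    using assms by (intro mult_left_mono) (auto simp: metro_line_def)
  then show ?thesis
    by (auto simp: travel_time_closed_form[OF assms(3)] max_def)
qed

lemma demand_ratio_nonneg:
  assumes "metro_line L" "j < segs L"
  shows "0 \<le> demand_ratio L j"
  using assms by (auto simp: metro_line_def demand_ratio_def)

lemma linear_travel_time_pos:
  assumes "metro_line L" "j < segs L"
  shows "0 < linear_travel_time L j"
proof -
  have "0 \<le> demand_ratio L j * g_min L j"
    using demand_ratio_nonneg[OF assms] assms by (auto simp: metro_line_def)
  moreover have "0 < r_nom L j"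
    using assms by (force simp: metro_line_def)
  ultimately show ?thesis
    by (simp add: linear_travel_time_def)
qed

lemma travel_time_pos:
  assumes "metro_line L" "j < segs L" "delta_w L j \<le> delta_r L j"
  shows "0 < travel_time L j h"
proof -
  have "0 \<le> g_max L j"
    using assms by (force simp: metro_line_def)
  then have "0 \<le> w_max L j"
    using demand_ratio_nonneg[OF assms(1,2)] by (simp add: w_max_eq)
  moreover have "0 < r_min L j"
    using assms by (simp add: metro_line_def)
  ultimately show ?thesis
    by (simp add: travel_time_closed_form[OF assms(3)] less_max_iff_disj)
qed

lemma travel_time_le_linear:
  assumes "delta_w L j \<le> delta_r L j"
  shows "travel_time L j h \<le> linear_travel_time L j"
  using assms
  by (auto simp: travel_time_closed_form linear_travel_time_def w_min_eq[symmetric]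
      delta_w_def delta_r_def)

text \<open>
  At a node without demand both laws are the nominal run time; at a node whose margins are equal,
  the run time reaches its minimum exactly when the dwell time saturates.
\<close>

lemma travel_time_eq_linear:
  assumes "metro_line L" "j < segs L" "delta_w L j \<le> delta_r L j"
    and "0 < demand L j \<and> delta_w L j < delta_r L j \<longrightarrow> h \<le> h_max L j"
  shows "travel_time L j h = linear_travel_time L j"
proof -
  have lower: "r_min L j + w_max L j \<le> linear_travel_time L j"
    using assms(3)
    by (simp add: linear_travel_time_def w_min_eq[symmetric] delta_w_def delta_r_def)
  have "0 \<le> demand L j"
    using assms by (simp add: metro_line_def)
  then consider "demand L j = 0" | "delta_w L j = delta_r L j" | "h \<le> h_max L j"
    using assms(3,4) by linarith
  then show ?thesis
  proof cases
    case 1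
    then show ?thesis
      using lower by (simp add: travel_time_closed_form[OF assms(3)] w_max_def)
  next
    case 2
    then have "linear_travel_time L j = r_min L j + w_max L j"
      by (simp add: linear_travel_time_def w_min_eq[symmetric] delta_w_def delta_r_def)
    then show ?thesis
      by (simp add: travel_time_closed_form[OF assms(3)])
  next
    case 3
    then have "demand L j * h \<le> w_max L j"
      unfolding w_max_def using \<open>0 \<le> demand L j\<close> by (rule mult_left_mono)
    then show ?thesis
      using lower by (simp add: travel_time_closed_form[OF assms(3)])
  qed
qed

section \<open>Constraints and retiming\<close>

text \<open>
  Both travel constraints are instances of one constraint with a headway-dependent travel time law
  \<open>F\<close>, so that properties of the two dynamics can be obtained at once.
\<close>

definition timed_constraint ::
    "metro \<Rightarrow> (nat \<Rightarrow> real \<Rightarrow> real) \<Rightarrow> departures \<Rightarrow> nat \<Rightarrow> nat \<Rightarrow> bool" where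
  "timed_constraint L F d k j \<longleftrightarrow>
    d (k - trains L j) (prv L j) + F j (headway d k j) \<le> d k j"

lemma travel_constraint_timed:
  "travel_constraint L = timed_constraint L (travel_time L)"
  by (simp add: fun_eq_iff travel_constraint_def timed_constraint_def travel_time_def add.assoc)

lemma linear_travel_constraint_timed:
  "linear_travel_constraint L = timed_constraint L (\<lambda>j h. linear_travel_time L j)"
  by (simp add: fun_eq_iff linear_travel_constraint_def timed_constraint_def
      linear_travel_time_def add.assoc)

lemma retime_same [simp]: "retime d k j t k j = t"
  by (simp add: retime_def)

lemma retime_other: "(k', i) \<noteq> (k, j) \<Longrightarrow> retime d k j t k' i = d k' i"
  by (auto simp: retime_def)

lemma headway_retime [simp]: "1 \<le> k \<Longrightarrow> headway (retime d k j t) k j = t - d (k - 1) j"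
  by (simp add: headway_def retime_other)

lemma retime_id [simp]: "retime d k j (d k j) = d"
  by (simp add: retime_def)

lemma nxt_less: "0 < segs L \<Longrightarrow> nxt L j < segs L"
  by (simp add: nxt_def)

lemma prv_less: "0 < segs L \<Longrightarrow> prv L j < segs L"
  by (simp add: prv_def)

lemma timed_constraint_retime:
  assumes "(k - trains L j, prv L j) \<noteq> (k, j)" "1 \<le> k"
  shows "timed_constraint L F (retime d k j t) k j \<longleftrightarrow>
    d (k - trains L j) (prv L j) + F j (t - d (k - 1) j) \<le> t"
  using assms by (simp add: timed_constraint_def retime_other)

lemma separation_constraint_retime:
  assumes "(k - trains_bar L (nxt L j), nxt L j) \<noteq> (k, j)"
  shows "separation_constraint L (retime d k j t) k j \<longleftrightarrow>
    d (k - trains_bar L (nxt L j)) (nxt L j) + s_min L (nxt L j) \<le> t"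
  using assms by (simp add: separation_constraint_def retime_other)

text \<open>
  A satisfied constraint with a positive travel time refers to a departure other than the
  constrained one, so the latter can be moved without moving the
  one it waits for.
\<close>

lemma timed_constraint_irreflexive:
  assumes "timed_constraint L F d k j" "\<And>h. 0 < F j h"
  shows "(k - trains L j, prv L j) \<noteq> (k, j)"
  using assms(1) assms(2)[of "headway d k j"] by (auto simp: timed_constraint_def)

lemma separation_constraint_irreflexive:
  assumes "separation_constraint L d k j" "metro_line L"
  shows "(k - trains_bar L (nxt L j), nxt L j) \<noteq> (k, j)"
  using assms nxt_less[of L j] by (force simp: separation_constraint_def metro_line_def)

section \<open>Propagation of the headway bound\<close>

text \<open>
  Suppose that \<open>d k j\<close> and the departures for which \<open>d (Suc k) j\<close> waits follow their predecessors
  within \<open>H\<close>.  The latter are at most \<open>H\<close> later than those for which \<open>d k j\<close> waits, and the travel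
  time at headway \<open>H\<close> is at most the one at the headway of \<open>d k j\<close>, as \<open>F\<close> is nonincreasing.  Hence \<open>d k j + H\<close> is a feasible time for the next departure, which
  therefore takes place by then.  Those in the same row \<open>Suc k\<close> for which it
  waits are strictly earlier, so the earliest departure violating the bound leads to a contradiction.
\<close>

lemma headway_le_initial_bound:
  assumes L: "metro_line L"
    and pos: "\<And>j h. j < segs L \<Longrightarrow> 0 < F j h"
    and anti: "\<And>j h h'. j < segs L \<Longrightarrow> h \<le> h' \<Longrightarrow> F j h' \<le> F j h"
    and dyn: "asap L (\<lambda>d k j. timed_constraint L F d k j \<and> separation_constraint L d k j) d"
    and init: "\<And>j. j < segs L \<Longrightarrow> headway d 1 j \<le> H"
    and k: "1 \<le> k" and j: "j < segs L"
  shows "headway d k j \<le> H"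
  using k j
proof (induction k arbitrary: j rule: dec_induct)
  case base
  then show ?case by (rule init)
next
  case (step k)
  have seg: "0 < segs L" and s_pos: "\<And>i. i < segs L \<Longrightarrow> 0 < s_min L i"
    and trains: "\<And>i. i < segs L \<Longrightarrow> trains L i \<in> {0, 1}"
    using L by (auto simp: metro_line_def)
  have timed: "timed_constraint L F d k' i" and sep: "separation_constraint L d k' i"
    and least: "\<And>t. timed_constraint L F (retime d k' i t) k' i \<Longrightarrow>
      separation_constraint L (retime d k' i t) k' i \<Longrightarrow> d k' i \<le> t"
    if "1 \<le> k'" "i < segs L" for k' i
    using dyn that by (auto simp: asap_def)
  let ?late = "{i. i < segs L \<and> H < headway d (Suc k) i}"
  have "?late = {}"
  proof (rule ccontr)
    assume "?late \<noteq> {}"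
    moreover have "finite ?late" by simp
    ultimately obtain i where "is_arg_min (d (Suc k)) (\<lambda>i. i \<in> ?late) i"
      using ex_is_arg_min_if_finite by blast
    then have i: "i < segs L" and late: "H < headway d (Suc k) i"
      and first: "\<And>i'. i' < segs L \<Longrightarrow> d (Suc k) i' < d (Suc k) i \<Longrightarrow> headway d (Suc k) i' \<le> H"
      by (auto simp: is_arg_min_def not_less[symmetric])
    let ?p = "prv L i" and ?q = "nxt L i"
    let ?b = "trains L i" and ?c = "trains_bar L (nxt L i)"
    have p: "?p < segs L" and q: "?q < segs L"
      using seg by (simp_all add: prv_less nxt_less)
    have k1: "1 \<le> k" using step.hyps by simp
    have timed': "d (Suc k - ?b) ?p + F i (headway d (Suc k) i) \<le> d (Suc k) i"
      and sep': "d (Suc k - ?c) ?q + s_min L ?q \<le> d (Suc k) i"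
      using timed[of "Suc k" i] sep[of "Suc k" i] i
      by (simp_all add: timed_constraint_def separation_constraint_def)
    have grow_p: "d (Suc k - ?b) ?p \<le> d (k - ?b) ?p + H"
    proof (cases "?b = 0")
      case True
      then have "d (Suc k) ?p < d (Suc k) i"
        using timed' pos[OF i, of "headway d (Suc k) i"] by simp
      then show ?thesis
        using first[OF p] True by (simp add: headway_def)
    next
      case False
      then have "?b = 1" using trains[OF i] by simp
      then show ?thesis
        using step.IH[OF p] by (simp add: headway_def)
    qed
    have grow_q: "d (Suc k - ?c) ?q \<le> d (k - ?c) ?q + H"
    proof (cases "?c = 0")
      case True
      then have "d (Suc k) ?q < d (Suc k) i"
        using sep' s_pos[OF q] by simp
      then show ?thesis
        using first[OF q] True by (simp add: headway_def)
    next
      case False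
      then have "?c = 1" using trains[OF q] by (auto simp: trains_bar_def)
      then show ?thesis
        using step.IH[OF q] by (simp add: headway_def)
    qed
    have "timed_constraint L F (retime d (Suc k) i (d k i + H)) (Suc k) i"
    proof -
      have "d (k - ?b) ?p + F i (headway d k i) \<le> d k i"
        using timed[OF k1 i] by (simp add: timed_constraint_def)
      moreover have "F i H \<le> F i (headway d k i)"
        using anti[OF i step.IH[OF i]] .
      ultimately have "d (Suc k - ?b) ?p + F i H \<le> d k i + H"
        using grow_p by linarith
      then show ?thesis
        using timed_constraint_irreflexive[OF timed[of "Suc k" i] pos] i
        by (simp add: timed_constraint_retime)
    qed
    moreover have "separation_constraint L (retime d (Suc k) i (d k i + H)) (Suc k) i"
    proof -
      have "d (Suc k - ?c) ?q + s_min L ?q \<le> d k i + H"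
        using sep[OF k1 i] grow_q by (simp add: separation_constraint_def)
      then show ?thesis
        using separation_constraint_irreflexive[OF sep[of "Suc k" i] L] i
        by (simp add: separation_constraint_retime)
    qed
    ultimately have "d (Suc k) i \<le> d k i + H"
      using least[of "Suc k" i] i by simp
    then show False
      using late by (simp add: headway_def)
  qed
  then show ?case
    using step.prems by (simp only: Collect_empty_eq not_less[symmetric]) blast
qed

section \<open>Equivalence of the two travel constraints\<close>

text \<open>
  A departure time \<open>t\<close> that exploits a travel time shorter than the linear one has a headway above
  \<open>h_max L j\<close>.  But under either constraint the actual departure, with its headway below \<open>h_max L j\<close>,
  respects the linear travel time; being later still, so does \<open>t\<close>.
\<close>

lemma travel_constraint_iff_linear:
  assumes L: "metro_line L" and j: "j < segs L" and k: "1 \<le> k"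
    and margin: "delta_w L j \<le> delta_r L j"
    and either: "travel_constraint L d k j \<or> linear_travel_constraint L d k j"
    and bound: "0 < demand L j \<and> delta_w L j < delta_r L j \<longrightarrow> headway d k j \<le> h_max L j"
  shows "travel_constraint L (retime d k j t) k j \<longleftrightarrow>
    linear_travel_constraint L (retime d k j t) k j"
proof -
  let ?p = "d (k - trains L j) (prv L j)" and ?C = "linear_travel_time L j"
  have linear: "?p + ?C \<le> d k j"
    using either travel_time_eq_linear[OF L j margin bound]
    by (auto simp: travel_constraint_timed linear_travel_constraint_timed timed_constraint_def)
  then have other: "(k - trains L j, prv L j) \<noteq> (k, j)"
    using linear_travel_time_pos[OF L j] by auto
  have "?p + ?C \<le> t" if "?p + travel_time L j (t - d (k - 1) j) \<le> t"
  proof (cases "0 < demand L j \<and> delta_w L j < delta_r L j \<longrightarrow> t - d (k - 1) j \<le> h_max L j")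
    case True
    then show ?thesis
      using that travel_time_eq_linear[OF L j margin True] by simp
  next
    case False
    then have "d k j \<le> t"
      using bound by (auto simp: headway_def)
    then show ?thesis
      using linear by simp
  qed
  moreover have "?p + travel_time L j (t - d (k - 1) j) \<le> t" if "?p + ?C \<le> t"
    using that travel_time_le_linear[OF margin, of "t - d (k - 1) j"] by linarith
  ultimately show ?thesis
    using other k
    by (auto simp: travel_constraint_timed linear_travel_constraint_timed timed_constraint_retime)
qed

text \<open>
  Nonlinearity arises only at nodes \<open>j\<close> with demand and a margin surplus.  There \<open>h_max L j\<close> bounds
  the initial headways of the whole line, so it is a bound that propagates.
\<close>

lemma travel_constraint_iff_linear_on_dynamics:
  assumes L: "metro_line L" and margin: "\<forall>j<segs L. delta_w L j \<le> delta_r L j"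
    and surplus: "surplus_margin_bound L d"
    and dyn: "metro_dynamics L d \<or> linear_metro_dynamics L d"
    and k: "1 \<le> k" and j: "j < segs L"
  shows "travel_constraint L (retime d k j t) k j \<longleftrightarrow>
    linear_travel_constraint L (retime d k j t) k j"
proof (rule travel_constraint_iff_linear[OF L j k])
  show "delta_w L j \<le> delta_r L j"
    using margin j by simp
  show "travel_constraint L d k j \<or> linear_travel_constraint L d k j"
    using dyn k j by (auto simp: metro_dynamics_def linear_metro_dynamics_def asap_def)
  show "0 < demand L j \<and> delta_w L j < delta_r L j \<longrightarrow> headway d k j \<le> h_max L j"
  proof
    assume "0 < demand L j \<and> delta_w L j < delta_r L j"
    then have init: "\<And>i. i < segs L \<Longrightarrow> headway d 1 i \<le> h_max L j"
      using surplus j by (simp add: surplus_margin_bound_def)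
    from dyn show "headway d k j \<le> h_max L j"
    proof
      assume "metro_dynamics L d"
      then show ?thesis
        unfolding metro_dynamics_def travel_constraint_timed
        using headway_le_initial_bound[where F = "travel_time L", OF L _ _ _ init k j]
          travel_time_pos[OF L] travel_time_antimono[OF L] margin
        by blast
    next
      assume "linear_metro_dynamics L d"
      then show ?thesis
        unfolding linear_metro_dynamics_def linear_travel_constraint_timed
        using headway_le_initial_bound[where F = "\<lambda>i h. linear_travel_time L i",
            OF L _ _ _ init k j] linear_travel_time_pos[OF L]
        by blast
    qed
  qed
qed

lemma metro_dynamics_iff_linear:
  assumes "metro_line L" "\<forall>j<segs L. delta_w L j \<le> delta_r L j" "surplus_margin_bound L d"
  shows "metro_dynamics L d \<longleftrightarrow> linear_metro_dynamics L d"
proof -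
  have "metro_dynamics L d \<longleftrightarrow> linear_metro_dynamics L d"
    if dyn: "metro_dynamics L d \<or> linear_metro_dynamics L d"
  proof -
    have retimed: "travel_constraint L (retime d k j t) k j \<longleftrightarrow>
        linear_travel_constraint L (retime d k j t) k j" if "1 \<le> k" "j < segs L" for k j t
      using travel_constraint_iff_linear_on_dynamics[OF assms dyn that] .
    (* Retiming to the actual departure time leaves the trajectory unchanged. *)
    have "travel_constraint L d k j \<longleftrightarrow> linear_travel_constraint L d k j"
      if "1 \<le> k" "j < segs L" for k j
      using retimed[OF that, of "d k j"] by simp
    with retimed show ?thesis
      by (auto simp: metro_dynamics_def linear_metro_dynamics_def asap_def)
  qed
  then show ?thesis by blast
qed

section \<open>The linear dynamics as a max-plus system\<close>

text \<open>
  In the linear constraints the headway no longer occurs, so moving \<open>d k j\<close> leaves their right-hand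
  sides fixed, and the least feasible time is the larger one of these.
\<close>

lemma linear_metro_dynamics_iff_max:
  assumes L: "metro_line L"
  shows "linear_metro_dynamics L d \<longleftrightarrow> (\<forall>k\<ge>1. \<forall>j<segs L.
    d k j = max (d (k - trains L j) (prv L j) + linear_travel_time L j)
                (d (k - trains_bar L (nxt L j)) (nxt L j) + s_min L (nxt L j)))"
proof -
  have "linear_travel_constraint L d k j \<and> separation_constraint L d k j \<and>
      (\<forall>t. linear_travel_constraint L (retime d k j t) k j \<and>
        separation_constraint L (retime d k j t) k j \<longrightarrow> d k j \<le> t) \<longleftrightarrow>
    d k j = max (d (k - trains L j) (prv L j) + linear_travel_time L j)
                (d (k - trains_bar L (nxt L j)) (nxt L j) + s_min L (nxt L j))"
    (is "?A \<longleftrightarrow> d k j = max ?u ?v")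
    if k: "1 \<le> k" and j: "j < segs L" for k j
  proof -
    have feasible: "linear_travel_constraint L d k j \<and> separation_constraint L d k j \<longleftrightarrow>
        ?u \<le> d k j \<and> ?v \<le> d k j"
      by (simp add: linear_travel_constraint_timed timed_constraint_def
          separation_constraint_def)
    have retimed: "linear_travel_constraint L (retime d k j t) k j \<and>
        separation_constraint L (retime d k j t) k j \<longleftrightarrow> max ?u ?v \<le> t"
      if "?u \<le> d k j" "?v \<le> d k j" for t
    proof -
      have "timed_constraint L (\<lambda>j h. linear_travel_time L j) d k j"
        and "separation_constraint L d k j"
        using that by (simp_all add: timed_constraint_def separation_constraint_def)
      then have "(k - trains L j, prv L j) \<noteq> (k, j)"
        and "(k - trains_bar L (nxt L j), nxt L j) \<noteq> (k, j)"
        using timed_constraint_irreflexive linear_travel_time_pos[OF L j]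
          separation_constraint_irreflexive[OF _ L] by blast+
      then show ?thesis
        using k by (simp add: linear_travel_constraint_timed timed_constraint_retime
            separation_constraint_retime)
    qed
    show ?thesis
    proof
      assume A: ?A
      then have "?u \<le> d k j" "?v \<le> d k j" using feasible by auto
      moreover from this have "d k j \<le> max ?u ?v" using A retimed by blast
      ultimately show "d k j = max ?u ?v" by simp
    next
      assume eq: "d k j = max ?u ?v"
      then have "?u \<le> d k j" "?v \<le> d k j" by simp_all
      then show ?A using feasible retimed eq by simp
    qed
  qed
  then show ?thesis
    by (simp add: linear_metro_dynamics_def asap_def)
qed

lemma max_plus_linear_on_cong:
  assumes "\<And>d. I d \<Longrightarrow> S d \<longleftrightarrow> S' d"
  shows "max_plus_linear_on n I S \<longleftrightarrow> max_plus_linear_on n I S'"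
  using assms by (simp add: max_plus_linear_on_def cong: imp_cong)

lemma linear_metro_dynamics_max_plus_linear:
  assumes "metro_line L"
  shows "max_plus_linear_on (segs L) I (linear_metro_dynamics L)"
proof -
  let ?E = "\<lambda>j. {(prv L j, trains L j, linear_travel_time L j),
    (nxt L j, trains_bar L (nxt L j), s_min L (nxt L j))}"
  have seg: "0 < segs L" and "\<And>j. j < segs L \<Longrightarrow> trains L j \<le> 1"
    using assms by (auto simp: metro_line_def)
  then have "\<forall>j<segs L. finite (?E j) \<and> ?E j \<noteq> {} \<and> (\<forall>(i, l, c) \<in> ?E j. i < segs L \<and> l \<le> 1)"
    by (simp add: prv_less nxt_less trains_bar_def)
  moreover have "{d (k - l) i + c | i l c. (i, l, c) \<in> ?E j} =
      {d (k - trains L j) (prv L j) + linear_travel_time L j,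
       d (k - trains_bar L (nxt L j)) (nxt L j) + s_min L (nxt L j)}" for d :: departures and k j
    by auto
  then have "linear_metro_dynamics L d \<longleftrightarrow> (\<forall>k\<ge>1. \<forall>j<segs L.
      d k j = Max {d (k - l) i + c | i l c. (i, l, c) \<in> ?E j})" for d
    unfolding linear_metro_dynamics_iff_max[OF assms] by simp
  ultimately show ?thesis
    unfolding max_plus_linear_on_def by (intro exI[of _ ?E]) blast
qed

theorem theorem5:
  fixes L :: metro
  assumes "metro_line L"
    and "\<forall>j<segs L. delta_r L j \<ge> delta_w L j"
  shows "max_plus_linear_on (segs L)
      (\<lambda>d. initial_headways_bounded L d \<and> surplus_margin_bound L d) (metro_dynamics L) \<and>
    (\<forall>d. initial_headways_bounded L d \<and> surplus_margin_bound L d \<longrightarrow>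
      (metro_dynamics L d \<longleftrightarrow> linear_metro_dynamics L d) \<and>
      (metro_dynamics L d \<longrightarrow>
        (\<forall>k\<ge>1. \<forall>j<segs L.
          (\<forall>t. travel_constraint L (retime d k j t) k j
                 \<longleftrightarrow> linear_travel_constraint L (retime d k j t) k j) \<and>
          d k j = max (d (k - trains L j) (prv L j) + r_nom L j + demand_ratio L j * g_min L j)
                      (d (k - trains_bar L (nxt L j)) (nxt L j) + s_min L (nxt L j)))))"
proof (intro conjI allI impI)
  fix d and k j :: nat and t :: real
  assume bounds: "initial_headways_bounded L d \<and> surplus_margin_bound L d"
  show equiv: "metro_dynamics L d \<longleftrightarrow> linear_metro_dynamics L d"
    using metro_dynamics_iff_linear[OF assms] bounds by blast
  assume dyn: "metro_dynamics L d" and "1 \<le> k" "j < segs L"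
  then show "travel_constraint L (retime d k j t) k j \<longleftrightarrow>
      linear_travel_constraint L (retime d k j t) k j"
    using travel_constraint_iff_linear_on_dynamics[OF assms] bounds by blast
  show "d k j = max (d (k - trains L j) (prv L j) + r_nom L j + demand_ratio L j * g_min L j)
      (d (k - trains_bar L (nxt L j)) (nxt L j) + s_min L (nxt L j))"
    using dyn equiv linear_metro_dynamics_iff_max[OF assms(1)] \<open>1 \<le> k\<close> \<open>j < segs L\<close>
    by (simp add: linear_travel_time_def add.assoc)
next
  show "max_plus_linear_on (segs L)
      (\<lambda>d. initial_headways_bounded L d \<and> surplus_margin_bound L d) (metro_dynamics L)"
    using linear_metro_dynamics_max_plus_linear[OF assms(1)] metro_dynamics_iff_linear[OF assms]
    by (subst max_plus_linear_on_cong[where S' = "linear_metro_dynamics L"]) auto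
qed

end
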